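(* Let $p$ be a natural number, $b_{i,k}\in\mathbb{R}$, and let ${\bf w}$ be the normal form $${\bf w}=-x\frac{\partial}{\partial y}-2y\frac{\partial}{\partial z}+z^p\Big(z\frac{\partial}{\partial y}+2y\frac{\partial}{\partial x}\Big)+\sum_{k=p+1}^\infty\sum_{i=0}^{[\frac{k+p}{2}]}b_{i,k}z^i(xz-y^2)^{k-2i+p}\Big(z\frac{\partial}{\partial y}+2y\frac{\partial}{\partial x}\Big).$$ The following are five alternative representations for ${\bf w}$: 1. A formal sum of ${\rm B}$-terms: ${\bf w}={\rm B}^1_{0,0}+{\rm B}^{-1}_{p,0}+\sum_{k=p+1}^\infty\sum_{i=0}^{[\frac{k+p}{2}]}b_{i,k}{\rm B}^{-1}_{i,k+p-2i}$. 2. The secondary invariant: ${\bf w}=\Psi\Big(-x-z^{p}-\sum_{k=p+1}^\infty\sum_{i=0}^{[\frac{k+p}{2}]}b_{i,k}z^{i+1}(xz-y^2)^{k+p-2i}\Big)$. 3. Vector potential: ${\bf w}={\bf curl}\Big(\big(x+z^{p+1}+\sum_{k=p+1}^\infty\sum_{i=0}^{[\frac{k+p}{2}]}\frac{\Delta^kz^{i+1}}{i+1}\big)[z,-2y,x]\Big)$. 4. Functionally independent Clebsch potentials: ${\bf w}=\nabla(xz-y^2)\times\nabla\Big(x+z^{p+1}+\sum_{k=p+1}^\infty\sum_{i=0}^{[\frac{k+p}{2}]}\frac{b_{i,k}z^{i+1}(xz-y^2)^{k+p-2i}}{i+1}\Big)$. 5. Poisson bracket: ${\bf w}=\sum_{j=1}^3\{x_j,{\bf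 I}(x,y,z)\}\,\mathbf{e}_j$, where $(x_1,x_2,x_3)=(x,y,z)$ and $${\bf I}(x,y,z)=x+\frac{1}{p+1}z^{p+1}+\sum_{k=p+1}^\infty\sum_{i=0}^{[\frac{k+p}{2}]}\frac{b_{i,k}}{i+1}z^{i+1}(xz-y^2)^{k-2i+p}.$$ Furthermore, $\{{\bf I}(x,y,z),\Delta\}=0$.
   Context: Work over $\mathbb{R}$ with coordinates $(x,y,z)$, $\Delta:=xz-y^2$; $[\cdot]$ on a number denotes the integer part. Vector fields (with formal power series coefficients) are identified both with derivations and with triples of components; $[v,w]=vw-wv$, ${\rm ad}_vw=[v,w]$; $\mathbf{e}_1,\mathbf{e}_2,\mathbf{e}_3$ is the standard basis of $\mathbb{R}^3$. Let ${\rm N}=x\frac{\partial}{\partial y}+2y\frac{\partial}{\partial z}$, ${\rm M}=z\frac{\partial}{\partial y}+2y\frac{\partial}{\partial x}$, $\kappa_{l,m}:=\frac{m!}{(m-l)!}$. For integers $i,k\ge0$, $-1\le l\le 2i+1$, $${\rm B}^l_{i,k}:=\frac{{\rm ad}_{\rm N}^{\,l+1}(z^i\Delta^k{\rm M})}{\kappa_{l+1,2i+2}},\qquad \mathfrak{b}^l_{i,k}:=-\frac{{\rm N}^{l+1}(z^{i+1}\Delta^k)}{(i+1)\kappa_{l+1,2i+2}},$$ where in the second formula ${\rm N}$ acts on functions as a differential operator. $\Psi$ is the Lie isomorphism determined linearly (term by term on formal sums) by $\Psi(\mathfrak{b}^l_{i,k})={\rm B}^l_{i,k}$. On $\mathbb{R}[[x,y,z]]$,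 $\{\cdot,\cdot\}$ is the Poisson bracket determined by $\{x,y\}=x$, $\{x,z\}=2y$, $\{y,z\}=z$, bilinearity, antisymmetry and the Leibniz rule.
   Formalization: Misprints corrected: in items 2–4 the term z^p or z^{p+1} becomes z^{p+1}/(p+1); in 2 the b_{i,k} terms get a factor 1/(i+1); in 3, Δ^k becomes b_{i,k}Δ^{k+p-2i}; in 4 the cross product is taken in the opposite order. *)

theory Defs
  imports "HOL-Analysis.Analysis" "HOL-Computational_Algebra.Formal_Power_Series"
begin

section \<open>Formal power series in three variables\<close>

text \<open>\<open>\<real>[[x,y,z]]\<close> is represented as \<open>\<real>[[x]][[y]][[z]]\<close>: the outermost variable is \<open>z\<close>.\<close>

type_synonym ser = "real fps fps fps"

definition cst :: "real \<Rightarrow> ser" where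
  "cst c = fps_const (fps_const (fps_const c))"

definition xx :: ser where "xx = fps_const (fps_const fps_X)"
definition yy :: ser where "yy = fps_const fps_X"
definition zz :: ser where "zz = fps_X"

definition mcoeff :: "ser \<Rightarrow> nat \<Rightarrow> nat \<Rightarrow> nat \<Rightarrow> real" where
  "mcoeff f a b c = fps_nth (fps_nth (fps_nth f c) b) a"

definition Dx :: "ser \<Rightarrow> ser" where
  "Dx f = Abs_fps (\<lambda>c. Abs_fps (\<lambda>b. fps_deriv (fps_nth (fps_nth f c) b)))"

definition Dy :: "ser \<Rightarrow> ser" where
  "Dy f = Abs_fps (\<lambda>c. fps_deriv (fps_nth f c))"

definition Dz :: "ser \<Rightarrow> ser" where
  "Dz f = fps_deriv f"

definition Delta :: ser where
  "Delta = xx * zz - yy ^ 2"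

text \<open>Infinite formal sums are taken coefficientwise: they make sense for families in which every
  monomial occurs in only finitely many members. (The topology that the library puts on
  \<^typ>\<open>ser\<close> is adic in \<open>z\<close> alone, so its infinite sums are not the ones needed
  here.) On other families \<open>formal_sum\<close> has no meaning.\<close>

definition formally_summable :: "('i \<Rightarrow> ser) \<Rightarrow> 'i set \<Rightarrow> bool" where
  "formally_summable F A \<longleftrightarrow> (\<forall>a b c. finite {s \<in> A. mcoeff (F s) a b c \<noteq> 0})"

definition formal_sum :: "('i \<Rightarrow> ser) \<Rightarrow> 'i set \<Rightarrow> ser" where
  "formal_sum F A = Abs_fps (\<lambda>c. Abs_fps (\<lambda>b. Abs_fps (\<lambda>a.
     \<Sum>s \<in> {s \<in> A. mcoeff (F s) a b c \<noteq> 0}. mcoeff (F s) a b c)))"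


section \<open>Vector fields\<close>

text \<open>A vector field is its triple of components; \<open>vf_apply\<close> is the derivation it defines.
  The derivation \<open>vw - wv\<close> has the \<open>j\<close>-th component \<open>v(w(x\<^sub>j)) - w(v(x\<^sub>j))\<close>,
  where \<open>w(x\<^sub>j)\<close> is the \<open>j\<close>-th component of \<open>w\<close>.\<close>

type_synonym vf = "ser ^ 3"

definition vf_apply :: "vf \<Rightarrow> ser \<Rightarrow> ser" where
  "vf_apply v f = vec_nth v 1 * Dx f + vec_nth v 2 * Dy f + vec_nth v 3 * Dz f"

definition lie :: "vf \<Rightarrow> vf \<Rightarrow> vf" where
  "lie v w = (\<chi> j. vf_apply v (vec_nth w j) - vf_apply w (vec_nth v j))"

definition coord :: "3 \<Rightarrow> ser" where
  "coord = vec_nth (vector [xx, yy, zz])"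

definition d_dx :: vf where "d_dx = axis 1 1"
definition d_dy :: vf where "d_dy = axis 2 1"
definition d_dz :: vf where "d_dz = axis 3 1"

definition vf_formal_sum :: "('i \<Rightarrow> vf) \<Rightarrow> 'i set \<Rightarrow> vf" where
  "vf_formal_sum F A = (\<chi> j. formal_sum (\<lambda>s. vec_nth (F s) j) A)"

definition grad :: "ser \<Rightarrow> vf" where
  "grad f = vector [Dx f, Dy f, Dz f]"

definition curl :: "vf \<Rightarrow> vf" where
  "curl v = vector [Dy (vec_nth v 3) - Dz (vec_nth v 2),
                    Dz (vec_nth v 1) - Dx (vec_nth v 3),
                    Dx (vec_nth v 2) - Dy (vec_nth v 1)]"

text \<open>The library's cross product is restricted to \<^typ>\<open>real ^ 3\<close>.\<close>

definition vf_cross :: "vf \<Rightarrow> vf \<Rightarrow> vf" where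
  "vf_cross v w = vector [vec_nth v 2 * vec_nth w 3 - vec_nth v 3 * vec_nth w 2,
                          vec_nth v 3 * vec_nth w 1 - vec_nth v 1 * vec_nth w 3,
                          vec_nth v 1 * vec_nth w 2 - vec_nth v 2 * vec_nth w 1]"

text \<open>Functional independence of formal functions: their gradients are linearly independent over
  \<open>\<real>[[x,y,z]]\<close> (equivalently, over its field of fractions).\<close>

definition functionally_independent :: "ser \<Rightarrow> ser \<Rightarrow> bool" where
  "functionally_independent f g \<longleftrightarrow>
     (\<forall>r s. r *s grad f + s *s grad g = 0 \<longrightarrow> r = 0 \<and> s = 0)"


section \<open>The fields \<open>B\<close>, the functions \<open>b\<close>, and the map \<open>\<Psi>\<close>\<close>

definition vN :: vf where
  "vN = xx *s d_dy + (2 * yy) *s d_dz"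

definition vM :: vf where
  "vM = zz *s d_dy + (2 * yy) *s d_dx"

definition kappa :: "nat \<Rightarrow> nat \<Rightarrow> real" where
  "kappa l m = fact m / fact (m - l)"

text \<open>Only the indices \<open>-1 \<le> l \<le> 2i+1\<close> are meaningful.\<close>

definition Bterm :: "int \<Rightarrow> nat \<Rightarrow> nat \<Rightarrow> vf" where
  "Bterm l i k = cst (1 / kappa (nat (l + 1)) (2 * i + 2)) *s
     (lie vN ^^ nat (l + 1)) ((zz ^ i * Delta ^ k) *s vM)"

definition bterm :: "int \<Rightarrow> nat \<Rightarrow> nat \<Rightarrow> ser" where
  "bterm l i k = - cst (1 / (real (i + 1) * kappa (nat (l + 1)) (2 * i + 2))) *
     (vf_apply vN ^^ nat (l + 1)) (zz ^ (i + 1) * Delta ^ k)"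

definition Bindex :: "(int \<times> nat \<times> nat) set" where
  "Bindex = {(l, i, k). - 1 \<le> l \<and> l \<le> 2 * int i + 1}"

text \<open>The term-by-term extension of \<open>bterm l i k \<mapsto> Bterm l i k\<close> to formal sums. Its
  domain is the set of all formal sums of the functions \<open>b\<close> (every such family is formally
  summable, since \<open>bterm l i k\<close> is homogeneous of degree \<open>i + 1 + 2k\<close>);
  \<open>Psi\<close> has no meaning elsewhere, for instance at nonzero constants.\<close>

definition Psi :: "ser \<Rightarrow> vf" where
  "Psi f = (THE v. \<exists>c.
     f = formal_sum (\<lambda>(l, i, k). cst (c l i k) * bterm l i k) Bindex \<and>
     v = vf_formal_sum (\<lambda>(l, i, k). cst (c l i k) *s Bterm l i k) Bindex)"


section \<open>The Poisson bracket on formal power series\<close>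

text \<open>These algebraic conditions determine the bracket on all power series without a continuity
  requirement: a linear map satisfying the Leibniz rule that vanishes at \<open>x, y, z\<close> maps
  every series into \<open>\<Inter>n. (x,y,z)\<^sup>n = 0\<close>.\<close>

definition is_poisson :: "(ser \<Rightarrow> ser \<Rightarrow> ser) \<Rightarrow> bool" where
  "is_poisson P \<longleftrightarrow>
     (\<forall>f g h. P (f + g) h = P f h + P g h) \<and>
     (\<forall>r f h. P (cst r * f) h = cst r * P f h) \<and>
     (\<forall>f g h. P h (f + g) = P h f + P h g) \<and>
     (\<forall>r f h. P h (cst r * f) = cst r * P h f) \<and>
     (\<forall>f g. P f g = - P g f) \<and>
     (\<forall>f g h. P f (g * h) = P f g * h + g * P f h) \<and>
     P xx yy = xx \<and> P xx zz = 2 * yy \<and> P yy zz = zz"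

definition poisson :: "ser \<Rightarrow> ser \<Rightarrow> ser" where
  "poisson = (THE P. is_poisson P)"

end

theory Submission
  imports Defs
begin

text \<open>Let \<open>H f = \<nabla>f \<times> \<nabla>\<Delta>\<close> be the Hamiltonian field of \<open>f\<close>. It satisfies \<open>H x = - N\<close>,
  \<open>H z = M\<close> and \<open>H \<Delta> = 0\<close>, and \<open>ad\<^sub>N (H f) = H (N f)\<close>, so that every \<open>B\<close>-term is
  \<open>- H\<close> of the corresponding \<open>b\<close>-term. As a first-order differential operator, \<open>H\<close> commutes with
  formal sums; hence \<open>\<Psi> f = - H f\<close> on the domain of \<open>\<Psi>\<close>, which is therefore well defined without
  any linear independence of the \<open>b\<close>-terms. All the representations then express that
  \<open>w = H I\<close>. The Poisson bracket is unique because a derivation that kills \<open>x, y, z\<close> takes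
  values of arbitrarily high order of vanishing: write \<open>f = c + x f\<^sub>1 + y f\<^sub>2 + z f\<^sub>3\<close> and iterate.\<close>


section \<open>Coefficients, constants and partial derivatives\<close>

lemma ser_eqI: "(\<And>a b c. mcoeff f a b c = mcoeff g a b c) \<Longrightarrow> f = g"
  by (simp add: mcoeff_def fps_eq_iff)

lemma mcoeff_add [simp]: "mcoeff (f + g) a b c = mcoeff f a b c + mcoeff g a b c"
  by (simp add: mcoeff_def)

lemma mcoeff_diff [simp]: "mcoeff (f - g) a b c = mcoeff f a b c - mcoeff g a b c"
  by (simp add: mcoeff_def)

lemma mcoeff_uminus [simp]: "mcoeff (- f) a b c = - mcoeff f a b c"
  by (simp add: mcoeff_def)

lemma mcoeff_0 [simp]: "mcoeff 0 a b c = 0"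
  by (simp add: mcoeff_def)

lemma mcoeff_sum: "mcoeff (sum F S) a b c = (\<Sum>s\<in>S. mcoeff (F s) a b c)"
  by (simp add: mcoeff_def fps_sum_nth)

lemma mcoeff_mult:
  "mcoeff (f * g) a b c =
    (\<Sum>k=0..c. \<Sum>j=0..b. \<Sum>i=0..a. mcoeff f i j k * mcoeff g (a - i) (b - j) (c - k))"
  by (simp add: mcoeff_def fps_mult_nth fps_sum_nth)

lemma mcoeff_Dx [simp]: "mcoeff (Dx f) a b c = of_nat (a + 1) * mcoeff f (a + 1) b c"
  by (simp add: mcoeff_def Dx_def)

lemma fps_nth_of_nat_mult: "fps_nth (of_nat n * (f :: 'a :: comm_ring_1 fps)) k = of_nat n * fps_nth f k"
  by (simp flip: fps_of_nat)

lemma mcoeff_Dy [simp]: "mcoeff (Dy f) a b c = of_nat (b + 1) * mcoeff f a (b + 1) c"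
  by (simp add: mcoeff_def Dy_def fps_nth_of_nat_mult del: of_nat_Suc)

lemma mcoeff_Dz [simp]: "mcoeff (Dz f) a b c = of_nat (c + 1) * mcoeff f a b (c + 1)"
  by (simp add: mcoeff_def Dz_def fps_nth_of_nat_mult del: of_nat_Suc)

lemma cst_mult: "cst (r * s) = cst r * cst s"
  by (simp add: cst_def)

lemma cst_1 [simp]: "cst 1 = 1"
  by (simp add: cst_def)

lemma cst_0 [simp]: "cst 0 = 0"
  by (simp add: cst_def)

lemma cst_of_nat: "cst (of_nat n) = of_nat n"
  by (simp add: cst_def fps_of_nat)

lemma mcoeff_cst_mult [simp]: "mcoeff (cst r * f) a b c = r * mcoeff f a b c"
  by (simp add: mcoeff_def cst_def)

lemma Dx_add [simp]: "Dx (f + g) = Dx f + Dx g"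
  and Dy_add [simp]: "Dy (f + g) = Dy f + Dy g"
  and Dz_add [simp]: "Dz (f + g) = Dz f + Dz g"
  by (rule ser_eqI; simp add: algebra_simps)+

lemma Dx_uminus [simp]: "Dx (- f) = - Dx f"
  and Dy_uminus [simp]: "Dy (- f) = - Dy f"
  and Dz_uminus [simp]: "Dz (- f) = - Dz f"
  by (rule ser_eqI; simp add: algebra_simps)+

lemma Dx_diff [simp]: "Dx (f - g) = Dx f - Dx g"
  and Dy_diff [simp]: "Dy (f - g) = Dy f - Dy g"
  and Dz_diff [simp]: "Dz (f - g) = Dz f - Dz g"
  by (rule ser_eqI; simp add: algebra_simps)+

lemma Dx_mult [simp]: "Dx (f * g) = Dx f * g + f * Dx g"
proof (rule fps_ext, rule fps_ext)
  fix c b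
  show "fps_nth (fps_nth (Dx (f * g)) c) b = fps_nth (fps_nth (Dx f * g + f * Dx g) c) b"
    by (simp add: Dx_def fps_mult_nth fps_sum_nth fps_deriv_sum sum.distrib add.commute)
qed

lemma Dy_mult [simp]: "Dy (f * g) = Dy f * g + f * Dy g"
proof (rule fps_ext)
  fix c
  show "fps_nth (Dy (f * g)) c = fps_nth (Dy f * g + f * Dy g) c"
    by (simp add: Dy_def fps_mult_nth fps_deriv_sum sum.distrib add.commute)
qed

lemma Dz_mult [simp]: "Dz (f * g) = Dz f * g + f * Dz g"
  by (simp add: Dz_def add.commute)

lemma D_cst [simp]: "Dx (cst r) = 0" "Dy (cst r) = 0" "Dz (cst r) = 0"
  by (auto simp: Dx_def Dy_def Dz_def cst_def fps_eq_iff)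

lemma D_0 [simp]: "Dx 0 = 0" "Dy 0 = 0" "Dz 0 = 0"
  using D_cst[of 0] by simp_all

lemma D_1 [simp]: "Dx 1 = 0" "Dy 1 = 0" "Dz 1 = 0"
  using D_cst[of 1] by simp_all

lemma D_of_nat [simp]: "Dx (of_nat n) = 0" "Dy (of_nat n) = 0" "Dz (of_nat n) = 0"
  using D_cst[of "of_nat n"] unfolding cst_of_nat by simp_all

lemma D_numeral [simp]: "Dx (numeral n) = 0" "Dy (numeral n) = 0" "Dz (numeral n) = 0"
  using D_of_nat[of "numeral n"] by simp_all

lemma D_xx [simp]: "Dx xx = 1" "Dy xx = 0" "Dz xx = 0"
  by (auto simp: Dx_def Dy_def Dz_def xx_def fps_eq_iff)

lemma D_yy [simp]: "Dx yy = 0" "Dy yy = 1" "Dz yy = 0"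
  by (auto simp: Dx_def Dy_def Dz_def yy_def fps_eq_iff fps_X_nth)

lemma D_zz [simp]: "Dx zz = 0" "Dy zz = 0" "Dz zz = 1"
  by (auto simp: Dx_def Dy_def Dz_def zz_def fps_eq_iff fps_X_nth)

lemma D_commute: "Dy (Dx f) = Dx (Dy f)" "Dz (Dx f) = Dx (Dz f)" "Dz (Dy f) = Dy (Dz f)"
  by (rule ser_eqI; simp)+

lemma D_Delta [simp]: "Dx Delta = zz" "Dy Delta = - 2 * yy" "Dz Delta = xx"
  by (simp_all add: Delta_def power2_eq_square)


section \<open>Order of vanishing\<close>

text \<open>Membership in the \<open>n\<close>-th power of the maximal ideal (x,y,z), read off from
  the coefficients. Counting total degree treats the three nested variables alike.\<close>

definition order_ge :: "nat \<Rightarrow> ser \<Rightarrow> bool" where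
  "order_ge n f \<longleftrightarrow> (\<forall>a b c. a + b + c < n \<longrightarrow> mcoeff f a b c = 0)"

lemma order_ge_0 [simp]: "order_ge 0 f"
  by (simp add: order_ge_def)

lemma order_ge_mono: "order_ge n f \<Longrightarrow> m \<le> n \<Longrightarrow> order_ge m f"
  by (simp add: order_ge_def)

lemma order_ge_add: "order_ge n f \<Longrightarrow> order_ge n g \<Longrightarrow> order_ge n (f + g)"
  and order_ge_uminus: "order_ge n f \<Longrightarrow> order_ge n (- f)"
  and order_ge_diff: "order_ge n f \<Longrightarrow> order_ge n g \<Longrightarrow> order_ge n (f - g)"
  and order_ge_cst_mult: "order_ge n f \<Longrightarrow> order_ge n (cst r * f)"
  by (simp_all add: order_ge_def)

text \<open>In total degree below \<open>m + n\<close>, every term of the Cauchy product has one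
  factor below its own order.\<close>

lemma order_ge_mult:
  assumes "order_ge m f" "order_ge n g"
  shows "order_ge (m + n) (f * g)"
  unfolding order_ge_def
proof (intro allI impI)
  fix a b c :: nat
  assume *: "a + b + c < m + n"
  have "mcoeff f i j k * mcoeff g (a - i) (b - j) (c - k) = 0"
    if "k \<le> c" "j \<le> b" "i \<le> a" for i j k
  proof (cases "i + j + k < m")
    case False
    with * that have "(a - i) + (b - j) + (c - k) < n" by linarith
    with assms(2) show ?thesis by (simp add: order_ge_def)
  qed (use assms(1) in \<open>simp add: order_ge_def\<close>)
  then show "mcoeff (f * g) a b c = 0"
    unfolding mcoeff_mult by (intro sum.neutral ballI) simp
qed

lemma order_ge_mult_left: "order_ge n g \<Longrightarrow> order_ge n (f * g)"
  using order_ge_mult[of 0 f n g] by simp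

lemma order_ge_power: "order_ge m f \<Longrightarrow> order_ge (n * m) (f ^ n)"
  by (induction n) (simp_all add: order_ge_mult)

lemma order_ge_vars: "order_ge 1 xx" "order_ge 1 yy" "order_ge 1 zz"
  by (simp_all add: order_ge_def mcoeff_def xx_def yy_def zz_def)

lemma order_ge_Delta: "order_ge 2 Delta"
  using order_ge_mult[OF order_ge_vars(1,3)] order_ge_mult[OF order_ge_vars(2,2)]
  by (simp add: Delta_def power2_eq_square order_ge_diff numeral_2_eq_2)

lemma order_ge_D:
  assumes "order_ge (Suc n) f"
  shows "order_ge n (Dx f)" "order_ge n (Dy f)" "order_ge n (Dz f)"
  using assms by (simp_all add: order_ge_def)

text \<open>A partial derivative lowers the order by at most one, and the coefficients of N vanish
  at the origin, which makes up for it. Hence iterating N never lowers the order.\<close>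

lemma order_ge_vf_apply_vN:
  assumes "order_ge n f"
  shows "order_ge n (vf_apply vN f)"
proof (cases n)
  case (Suc m)
  have "order_ge (1 + m) (xx * Dy f)" "order_ge (1 + m) (yy * Dz f)"
    using order_ge_mult[OF order_ge_vars(1) order_ge_D(2)[of m f]]
      order_ge_mult[OF order_ge_vars(2) order_ge_D(3)[of m f]] assms Suc by simp_all
  then show ?thesis
    using Suc by (simp add: vf_apply_def vN_def d_dy_def d_dz_def axis_def mult.assoc
        order_ge_add order_ge_mult_left)
qed simp


section \<open>Formal sums\<close>

lemma mcoeff_formal_sum:
  "mcoeff (formal_sum F A) a b c = (\<Sum>s \<in> {s \<in> A. mcoeff (F s) a b c \<noteq> 0}. mcoeff (F s) a b c)"
  by (simp add: mcoeff_def formal_sum_def)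

text \<open>Replaces the support, which depends on the family, by any finite set containing it, so
  that several families can be summed over one common set.\<close>

lemma mcoeff_formal_sum_superset:
  assumes "finite S" "S \<subseteq> A" "\<And>s. s \<in> A - S \<Longrightarrow> mcoeff (F s) a b c = 0"
  shows "mcoeff (formal_sum F A) a b c = (\<Sum>s\<in>S. mcoeff (F s) a b c)"
  unfolding mcoeff_formal_sum
  by (rule sum.mono_neutral_left) (use assms in auto)

lemma formal_sum_cong: "(\<And>s. s \<in> A \<Longrightarrow> F s = G s) \<Longrightarrow> formal_sum F A = formal_sum G A"
  by (rule ser_eqI) (simp add: mcoeff_formal_sum cong: conj_cong)

lemma formally_summableI_order:
  assumes "\<And>s. s \<in> A \<Longrightarrow> order_ge (d s) (F s)" and "\<And>n. finite {s \<in> A. d s \<le> n}"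
  shows "formally_summable F A"
  unfolding formally_summable_def
proof (intro allI)
  fix a b c
  have "{s \<in> A. mcoeff (F s) a b c \<noteq> 0} \<subseteq> {s \<in> A. d s \<le> a + b + c}"
    using assms(1) by (force simp: order_ge_def not_le)
  then show "finite {s \<in> A. mcoeff (F s) a b c \<noteq> 0}"
    using assms(2) by (rule finite_subset)
qed

lemma formal_sum_finite: "finite A \<Longrightarrow> formal_sum F A = sum F A"
  by (rule ser_eqI, subst mcoeff_formal_sum_superset[of A A]) (simp_all add: mcoeff_sum)

lemma formal_sum_add:
  assumes "formally_summable F A" "formally_summable G A"
  shows "formal_sum (\<lambda>s. F s + G s) A = formal_sum F A + formal_sum G A"
proof (rule ser_eqI)
  fix a b c
  let ?S = "{s \<in> A. mcoeff (F s) a b c \<noteq> 0} \<union> {s \<in> A. mcoeff (G s) a b c \<noteq> 0}"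
  have fin: "finite ?S" using assms by (simp add: formally_summable_def)
  have "mcoeff (formal_sum H A) a b c = (\<Sum>s\<in>?S. mcoeff (H s) a b c)"
    if "H = F \<or> H = G \<or> H = (\<lambda>s. F s + G s)" for H
    by (rule mcoeff_formal_sum_superset) (use fin that in auto)
  then show "mcoeff (formal_sum (\<lambda>s. F s + G s) A) a b c = mcoeff (formal_sum F A + formal_sum G A) a b c"
    by (simp add: sum.distrib)
qed

lemma formal_sum_mono_neutral:
  assumes "B \<subseteq> A" "\<And>s. s \<in> A - B \<Longrightarrow> F s = 0"
  shows "formal_sum F A = formal_sum F B"
proof (rule ser_eqI)
  fix a b c
  have "{s \<in> A. mcoeff (F s) a b c \<noteq> 0} = {s \<in> B. mcoeff (F s) a b c \<noteq> 0}"
    using assms by (auto; metis DiffI mcoeff_0)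
  then show "mcoeff (formal_sum F A) a b c = mcoeff (formal_sum F B) a b c"
    by (simp add: mcoeff_formal_sum)
qed

lemma formal_sum_reindex:
  assumes "inj_on h A"
  shows "formal_sum F (h ` A) = formal_sum (F \<circ> h) A"
proof (rule ser_eqI)
  fix a b c
  have "{s \<in> h ` A. mcoeff (F s) a b c \<noteq> 0} = h ` {s \<in> A. mcoeff (F (h s)) a b c \<noteq> 0}"
    by auto
  moreover have "inj_on h {s \<in> A. mcoeff (F (h s)) a b c \<noteq> 0}"
    using assms by (rule inj_on_subset) auto
  ultimately show "mcoeff (formal_sum F (h ` A)) a b c = mcoeff (formal_sum (F \<circ> h) A) a b c"
    by (simp add: mcoeff_formal_sum sum.reindex)
qed

text \<open>Links the normal form, summed over \<open>k\<close> with a finite inner sum over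
  \<open>i\<close>, to the single family of index triples used by \<open>Psi\<close>.\<close>

lemma formal_sum_Sigma:
  assumes "formally_summable (\<lambda>(s, t). F s t) (Sigma A B)" "\<And>s. s \<in> A \<Longrightarrow> finite (B s)"
  shows "formal_sum (\<lambda>(s, t). F s t) (Sigma A B) = formal_sum (\<lambda>s. \<Sum>t\<in>B s. F s t) A"
proof (rule ser_eqI)
  fix a b c
  \<comment> \<open>Terms may cancel inside an inner sum, so \<open>S\<close> collects the outer
    indices before grouping and only contains the support of the grouped family.\<close>
  define S where "S = fst ` {u \<in> Sigma A B. mcoeff (case u of (s, t) \<Rightarrow> F s t) a b c \<noteq> 0}"
  have finS: "finite S" and subS: "S \<subseteq> A"
    using assms(1) by (auto simp: S_def formally_summable_def)
  have zero: "mcoeff (F s t) a b c = 0" if "s \<in> A - S" "t \<in> B s" for s t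
    using that by (force simp: S_def)
  have "mcoeff (formal_sum (\<lambda>(s, t). F s t) (Sigma A B)) a b c
      = (\<Sum>u\<in>Sigma S B. mcoeff (case u of (s, t) \<Rightarrow> F s t) a b c)"
    by (rule mcoeff_formal_sum_superset) (use finS subS assms(2) zero in auto)
  also have "\<dots> = (\<Sum>s\<in>S. \<Sum>t\<in>B s. mcoeff (F s t) a b c)"
    using finS subS assms(2) by (subst sum.Sigma) (auto simp: case_prod_unfold)
  also have "\<dots> = mcoeff (formal_sum (\<lambda>s. \<Sum>t\<in>B s. F s t) A) a b c"
    by (subst mcoeff_formal_sum_superset[OF finS subS]) (auto simp: mcoeff_sum zero)
  finally show "mcoeff (formal_sum (\<lambda>(s, t). F s t) (Sigma A B)) a b c
      = mcoeff (formal_sum (\<lambda>s. \<Sum>t\<in>B s. F s t) A) a b c" .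
qed

lemma formally_summable_Sigma:
  assumes "formally_summable (\<lambda>(s, t). F s t) (Sigma A B)"
  shows "formally_summable (\<lambda>s. \<Sum>t\<in>B s. F s t) A"
  unfolding formally_summable_def
proof (intro allI)
  fix a b c
  have "{s \<in> A. mcoeff (\<Sum>t\<in>B s. F s t) a b c \<noteq> 0}
      \<subseteq> fst ` {u \<in> Sigma A B. mcoeff (case u of (s, t) \<Rightarrow> F s t) a b c \<noteq> 0}"
    by (force simp: mcoeff_sum elim: sum.not_neutral_contains_not_neutral)
  then show "finite {s \<in> A. mcoeff (\<Sum>t\<in>B s. F s t) a b c \<noteq> 0}"
    using assms by (simp add: formally_summable_def finite_subset)
qed

text \<open>An additive operator that lowers the order by at most one is continuous in the
  (x,y,z)-adic topology, so it passes through formal sums.\<close>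

lemma formal_sum_additive:
  assumes add: "Modules.additive T" and ord: "\<And>n f. order_ge (Suc n) f \<Longrightarrow> order_ge n (T f)"
    and summable: "formally_summable F A"
  shows "T (formal_sum F A) = formal_sum (\<lambda>s. T (F s)) A"
proof (rule ser_eqI)
  fix a b c
  \<comment> \<open>The coefficient at \<open>a b c\<close> of \<open>T f\<close> depends only on
    \<open>f\<close> modulo order \<open>Suc n\<close>. The box \<open>J\<close> contains all
    exponents of total degree at most \<open>n\<close>, so outside the finite set \<open>S\<close>
    every member has order at least \<open>Suc n\<close>.\<close>
  define n where "n = Suc (a + b + c)"
  define J where "J = {..n} \<times> {..n} \<times> {..n}"
  define S where "S = (\<Union>(i, j, k)\<in>J. {s \<in> A. mcoeff (F s) i j k \<noteq> 0})"
  have finS: "finite S" and subS: "S \<subseteq> A"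
    using summable by (auto simp: S_def J_def formally_summable_def)
  have zero: "mcoeff (F s) i j k = 0" if "s \<in> A - S" "i + j + k < Suc n" for s i j k
    using that by (force simp: S_def J_def)
  have "order_ge (Suc n) (formal_sum F A - sum F S)"
    unfolding order_ge_def mcoeff_diff mcoeff_sum
    by (intro allI impI) (subst mcoeff_formal_sum_superset[OF finS subS], auto intro: zero)
  then have "order_ge n (T (formal_sum F A) - (\<Sum>s\<in>S. T (F s)))"
    using ord by (simp flip: Modules.additive.sum[OF add] Modules.additive.diff[OF add])
  then have "mcoeff (T (formal_sum F A)) a b c = (\<Sum>s\<in>S. mcoeff (T (F s)) a b c)"
    by (simp add: order_ge_def n_def mcoeff_sum)
  also have "\<dots> = mcoeff (formal_sum (\<lambda>s. T (F s)) A) a b c"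
  proof (rule mcoeff_formal_sum_superset[OF finS subS, symmetric])
    fix s assume "s \<in> A - S"
    then have "order_ge n (T (F s))"
      using zero by (intro ord) (simp add: order_ge_def)
    then show "mcoeff (T (F s)) a b c = 0"
      by (simp add: order_ge_def n_def)
  qed
  finally show "mcoeff (T (formal_sum F A)) a b c = mcoeff (formal_sum (\<lambda>s. T (F s)) A) a b c" .
qed


section \<open>Hamiltonian vector fields\<close>

text \<open>The order of the factors fixes the sign: the \<open>j\<close>-th component is the
  bracket {x_j, f}, not its negative.\<close>

definition hamiltonian :: "ser \<Rightarrow> vf" where
  "hamiltonian f = vf_cross (grad f) (grad Delta)"

lemma hamiltonian_nth [simp]:
  "vec_nth (hamiltonian f) 1 = xx * Dy f + 2 * yy * Dz f"
  "vec_nth (hamiltonian f) 2 = zz * Dz f - xx * Dx f"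
  "vec_nth (hamiltonian f) 3 = - (2 * yy * Dx f) - zz * Dy f"
  by (simp_all add: hamiltonian_def vf_cross_def grad_def algebra_simps)

lemma vN_nth [simp]: "vec_nth vN 1 = 0" "vec_nth vN 2 = xx" "vec_nth vN 3 = 2 * yy"
  by (simp_all add: vN_def d_dy_def d_dz_def axis_def)

lemma vM_nth [simp]: "vec_nth vM 1 = 2 * yy" "vec_nth vM 2 = zz" "vec_nth vM 3 = 0"
  by (simp_all add: vM_def d_dy_def d_dx_def axis_def)

lemma hamiltonian_add [simp]: "hamiltonian (f + g) = hamiltonian f + hamiltonian g"
  and hamiltonian_uminus [simp]: "hamiltonian (- f) = - hamiltonian f"
  and hamiltonian_cst_mult [simp]: "hamiltonian (cst r * f) = cst r *s hamiltonian f"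
  and hamiltonian_mult: "hamiltonian (f * g) = f *s hamiltonian g + g *s hamiltonian f"
  by (simp_all add: vec_eq_iff forall_3 algebra_simps)

lemma hamiltonian_diff [simp]: "hamiltonian (f - g) = hamiltonian f - hamiltonian g"
  by (simp add: vec_eq_iff forall_3 algebra_simps)

lemma hamiltonian_0 [simp]: "hamiltonian 0 = 0"
  using hamiltonian_cst_mult[of 0 0] by simp

lemma hamiltonian_sum: "hamiltonian (sum F S) = (\<Sum>s\<in>S. hamiltonian (F s))"
  by (induction S rule: infinite_finite_induct) simp_all

lemma hamiltonian_xx: "hamiltonian xx = - vN"
  and hamiltonian_zz: "hamiltonian zz = vM"
  and hamiltonian_Delta: "hamiltonian Delta = 0"
  by (simp_all add: vec_eq_iff forall_3 algebra_simps)

lemma hamiltonian_Delta_power: "hamiltonian (Delta ^ k) = 0"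
proof (induction k)
  case 0
  show ?case by (simp add: vec_eq_iff forall_3)
qed (simp add: hamiltonian_mult hamiltonian_Delta)

lemma hamiltonian_zz_power: "hamiltonian (zz ^ Suc i) = (of_nat (Suc i) * zz ^ i) *s vM"
  by (induction i)
    (simp_all add: hamiltonian_mult[of zz] hamiltonian_zz vec_eq_iff algebra_simps)

text \<open>H is a derivation that kills \<open>Delta\<close> and maps \<open>zz\<close> to
  \<open>vM\<close>, so differentiating the power of z produces the factor i + 1. This is the origin
  of the divisors i + 1 in the b-terms and in \<open>I\<close>.\<close>

lemma hamiltonian_zz_Delta:
  "hamiltonian (cst (r / real (Suc i)) * (zz ^ Suc i * Delta ^ k)) = (cst r * zz ^ i * Delta ^ k) *s vM"
proof -
  have "cst (r / real (Suc i)) * of_nat (Suc i) = cst r"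
    by (simp flip: cst_of_nat cst_mult del: of_nat_Suc)
  then have "cst (r / real (Suc i)) * (Delta ^ k * (of_nat (Suc i) * zz ^ i)) = cst r * zz ^ i * Delta ^ k"
    by (metis (no_types, lifting) mult.assoc mult.commute)
  from arg_cong[OF this, of "\<lambda>c. c *s vM"] show ?thesis
    by (simp only: hamiltonian_cst_mult) (simp add: hamiltonian_mult[of "zz ^ Suc i"] hamiltonian_Delta_power hamiltonian_zz_power vector_smult_assoc
        del: power_Suc of_nat_Suc)
qed

text \<open>An instance of \<open>[H f, H g] = H {g, f}\<close>, since \<open>N = H (- x)\<close> and \<open>{f, - x} = N f\<close>.\<close>

lemma lie_vN_hamiltonian: "lie vN (hamiltonian f) = hamiltonian (vf_apply vN f)"
  by (simp add: lie_def vec_eq_iff forall_3 vf_apply_def D_commute algebra_simps)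

lemma lie_vN_power_hamiltonian:
  "(lie vN ^^ n) (hamiltonian f) = hamiltonian ((vf_apply vN ^^ n) f)"
  by (induction n) (simp_all add: lie_vN_hamiltonian)

section \<open>The B-terms as Hamiltonian fields\<close>

lemma vf_apply_cst_mult: "vf_apply v (cst r * f) = cst r * vf_apply v f"
  by (simp add: vf_apply_def algebra_simps)

lemma vf_apply_power_cst_mult: "(vf_apply v ^^ n) (cst r * f) = cst r * (vf_apply v ^^ n) f"
  by (induction n) (simp_all add: vf_apply_cst_mult)

lemma Bterm_eq_hamiltonian: "Bterm l i k = - hamiltonian (bterm l i k)"
proof -
  define n where "n = nat (l + 1)"
  define f where "f = (vf_apply vN ^^ n) (zz ^ Suc i * Delta ^ k)"
  \<comment> \<open>The field to which ad_N is applied is already Hamiltonian, so all powers of ad_N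
    turn into powers of N acting on the function.\<close>
  have "(zz ^ i * Delta ^ k) *s vM = hamiltonian (cst (1 / real (Suc i)) * (zz ^ Suc i * Delta ^ k))"
    by (subst hamiltonian_zz_Delta) simp
  then have "(lie vN ^^ n) ((zz ^ i * Delta ^ k) *s vM) = cst (1 / real (Suc i)) *s hamiltonian f"
    by (simp only: lie_vN_power_hamiltonian)
      (simp only: f_def vf_apply_power_cst_mult hamiltonian_cst_mult)
  then have "Bterm l i k = cst (1 / kappa n (2 * i + 2)) *s (cst (1 / real (Suc i)) *s hamiltonian f)"
    by (simp only: Bterm_def n_def)
  moreover have "bterm l i k = - (cst (1 / (real (Suc i) * kappa n (2 * i + 2))) * f)"
    by (simp add: bterm_def n_def f_def)
  ultimately show ?thesis
    by (simp add: mult.commute[of "real (Suc i)"] flip: cst_mult del: of_nat_Suc)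
qed

text \<open>Each component of H is a first-order operator without zeroth-order term, hence additive
  and lowering the order by at most one.\<close>

lemma hamiltonian_formal_sum:
  assumes "formally_summable F A"
  shows "hamiltonian (formal_sum F A) = vf_formal_sum (\<lambda>s. hamiltonian (F s)) A"
proof -
  have "vec_nth (hamiltonian (formal_sum F A)) j = formal_sum (\<lambda>s. vec_nth (hamiltonian (F s)) j) A" for j
  proof (rule formal_sum_additive[OF _ _ assms])
    show "Modules.additive (\<lambda>f. vec_nth (hamiltonian f) j)"
      by unfold_locales simp
    fix n f assume "order_ge (Suc n) f"
    then show "order_ge n (vec_nth (hamiltonian f) j)"
      using exhaust_3[of j]
      by (auto intro!: order_ge_add order_ge_diff order_ge_uminus order_ge_mult_left order_ge_D)
  qed
  then show ?thesis
    by (simp add: vf_formal_sum_def vec_eq_iff)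
qed

text \<open>The vector (z, -2y, x) is the gradient of \<open>Delta\<close>, hence curl-free, and
  curl (f grad Delta) = grad f x grad Delta.\<close>

lemma hamiltonian_eq_curl: "hamiltonian f = curl (f *s vector [zz, - 2 * yy, xx])"
  by (simp add: vec_eq_iff forall_3 curl_def)

text \<open>Crossing a linear relation between the two gradients with either gradient leaves one
  coefficient times H f, and the series ring has no zero divisors.\<close>

lemma functionally_independent_Delta:
  assumes "hamiltonian f \<noteq> 0"
  shows "functionally_independent Delta f"
  unfolding functionally_independent_def
proof (intro allI impI)
  fix r s :: ser
  assume *: "r *s grad Delta + s *s grad f = 0"
  have s: "s * Dx f = - (r * zz)" "s * Dy f = 2 * yy * r" "s * Dz f = - (r * xx)"
    using * by (simp_all add: vec_eq_iff forall_3 grad_def eq_neg_iff_add_eq_0 algebra_simps)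
  have r: "r * zz = - (s * Dx f)" "2 * yy * r = s * Dy f" "r * xx = - (s * Dz f)"
    by (simp_all add: s)
  \<comment> \<open>These are the components of s grad f x grad Delta. By the relation, s grad f = -
    r grad Delta, so they vanish.\<close>
  have "s * (xx * Dy f + 2 * yy * Dz f) = xx * (s * Dy f) + 2 * yy * (s * Dz f)"
    "s * (zz * Dz f - xx * Dx f) = zz * (s * Dz f) - xx * (s * Dx f)"
    "s * (- (2 * yy * Dx f) - zz * Dy f) = - (2 * yy * (s * Dx f)) - zz * (s * Dy f)"
    by (simp_all add: algebra_simps)
  then have "s * (xx * Dy f + 2 * yy * Dz f) = 0"
    "s * (zz * Dz f - xx * Dx f) = 0"
    "s * (- (2 * yy * Dx f) - zz * Dy f) = 0"
    unfolding s by (simp_all add: algebra_simps)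
  then have "s *s hamiltonian f = 0"
    unfolding vec_eq_iff forall_3 vector_smult_component hamiltonian_nth zero_index by blast
  \<comment> \<open>The same with r grad Delta = - s grad f, which gives a multiple of grad f x grad
    f.\<close>
  moreover have "r * (xx * Dy f + 2 * yy * Dz f) = (r * xx) * Dy f + (2 * yy * r) * Dz f"
    "r * (zz * Dz f - xx * Dx f) = (r * zz) * Dz f - (r * xx) * Dx f"
    "r * (- (2 * yy * Dx f) - zz * Dy f) = - ((2 * yy * r) * Dx f) - (r * zz) * Dy f"
    by (simp_all add: algebra_simps)
  then have "r * (xx * Dy f + 2 * yy * Dz f) = 0"
    "r * (zz * Dz f - xx * Dx f) = 0"
    "r * (- (2 * yy * Dx f) - zz * Dy f) = 0"
    unfolding r by (simp_all add: algebra_simps)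
  then have "r *s hamiltonian f = 0"
    unfolding vec_eq_iff forall_3 vector_smult_component hamiltonian_nth zero_index by blast
  ultimately show "r = 0 \<and> s = 0"
    using assms by simp
qed


section \<open>The map \<open>\<Psi>\<close>\<close>

text \<open>A bound below the actual degree i + 1 + 2k; what matters is that it does not depend on
  \<open>l\<close> and grows with both \<open>i\<close> and \<open>k\<close>.\<close>

lemma order_ge_bterm: "order_ge (i + k) (bterm l i k)"
proof -
  have "order_ge (Suc i * 1 + k * 2) (zz ^ Suc i * Delta ^ k)"
    by (intro order_ge_mult order_ge_power order_ge_vars order_ge_Delta)
  then have "order_ge (i + k) (zz ^ Suc i * Delta ^ k)"
    by (rule order_ge_mono) simp
  then have "order_ge (i + k) ((vf_apply vN ^^ n) (zz ^ Suc i * Delta ^ k))" for n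
    by (induction n) (simp_all add: order_ge_vf_apply_vN)
  then show ?thesis
    by (simp add: bterm_def order_ge_uminus order_ge_mult_left)
qed

lemma formally_summable_bterm:
  "formally_summable (\<lambda>(l, i, k). cst (c l i k) * bterm l i k) Bindex"
proof (rule formally_summableI_order[where d = "\<lambda>(l, i, k). i + k"])
  show "order_ge (case s of (l, i, k) \<Rightarrow> i + k)
      (case s of (l, i, k) \<Rightarrow> cst (c l i k) * bterm l i k)" for s
    by (auto simp: order_ge_cst_mult order_ge_bterm split: prod.splits)
  fix n
  \<comment> \<open>Bounding \<open>i\<close> also bounds \<open>l\<close>, by the constraint l
    \<le> 2i + 1 in \<open>Bindex\<close>.\<close>
  have "{s \<in> Bindex. (case s of (l, i, k) \<Rightarrow> i + k) \<le> n} \<subseteq> {- 1..2 * int n + 1} \<times> {..n} \<times> {..n}"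
    by (auto simp: Bindex_def)
  then show "finite {s \<in> Bindex. (case s of (l, i, k) \<Rightarrow> i + k) \<le> n}"
    by (rule finite_subset) simp
qed

lemma Psi_eq_hamiltonian:
  assumes "f = formal_sum (\<lambda>(l, i, k). cst (c l i k) * bterm l i k) Bindex"
  shows "Psi f = - hamiltonian f"
proof -
  \<comment> \<open>Proved for every \<open>c\<close>: any coefficient family representing
    \<open>f\<close> yields the same field, which is the uniqueness that the description in
    \<open>Psi\<close> asks for.\<close>
  have *: "vf_formal_sum (\<lambda>(l, i, k). cst (c l i k) *s Bterm l i k) Bindex
      = - hamiltonian (formal_sum (\<lambda>(l, i, k). cst (c l i k) * bterm l i k) Bindex)" for c
  proof -
    have "formally_summable (\<lambda>s. - (case s of (l, i, k) \<Rightarrow> cst (c l i k) * bterm l i k)) Bindex"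
      using formally_summable_bterm[of c] by (simp add: formally_summable_def)
    from hamiltonian_formal_sum[OF this]
    have "hamiltonian (formal_sum (\<lambda>s. - (case s of (l, i, k) \<Rightarrow> cst (c l i k) * bterm l i k)) Bindex)
      = vf_formal_sum (\<lambda>(l, i, k). cst (c l i k) *s Bterm l i k) Bindex"
      by (simp add: case_prod_unfold Bterm_eq_hamiltonian vector_smult_rneg)
    moreover have "formal_sum (\<lambda>s. - F s) A = - formal_sum F A" for F and A :: "(int \<times> nat \<times> nat) set"
      by (rule ser_eqI) (simp add: mcoeff_formal_sum sum_negf)
    ultimately show ?thesis by simp
  qed
  show ?thesis
    unfolding Psi_def
    by (rule the_equality) (use assms * in auto)
qed


section \<open>The Poisson bracket\<close>

text \<open>The Jacobian determinant of \<open>f\<close>, \<open>g\<close> and \<open>Delta\<close>,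
  expanded along the gradient of \<open>Delta\<close>.\<close>

definition jacobi_bracket :: "ser \<Rightarrow> ser \<Rightarrow> ser" where
  "jacobi_bracket f g = xx * (Dx f * Dy g - Dy f * Dx g)
     + 2 * yy * (Dx f * Dz g - Dz f * Dx g) + zz * (Dy f * Dz g - Dz f * Dy g)"

lemma is_poisson_jacobi_bracket: "is_poisson jacobi_bracket"
  by (simp add: is_poisson_def jacobi_bracket_def algebra_simps)

text \<open>Each layer of the nested series ring is split into its constant term and a multiple of
  its variable, from the outermost variable z inwards.\<close>

lemma ser_decompose: "\<exists>r f1 f2 f3. f = cst r + xx * f1 + yy * f2 + zz * f3"
proof -
  have shift: "g = fps_const (fps_nth g 0) + fps_X * fps_shift 1 g" for g :: "'a :: comm_ring_1 fps"
    by (rule fps_ext) simp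
  define g where "g = fps_nth f 0"
  define h where "h = fps_nth g 0"
  have f: "f = fps_const g + zz * fps_shift 1 f"
    unfolding zz_def g_def by (rule shift)
  have g: "g = fps_const h + fps_X * fps_shift 1 g"
    unfolding h_def by (rule shift)
  have h: "h = fps_const (fps_nth h 0) + fps_X * fps_shift 1 h"
    by (rule shift)
  have "fps_const g = fps_const (fps_const h) + yy * fps_const (fps_shift 1 g)"
    by (subst g) (simp only: yy_def fps_const_mult fps_const_add)
  moreover have "fps_const (fps_const h)
      = cst (fps_nth h 0) + xx * fps_const (fps_const (fps_shift 1 h))"
    by (subst h) (simp only: cst_def xx_def fps_const_mult fps_const_add)
  ultimately have "f = cst (fps_nth h 0) + xx * fps_const (fps_const (fps_shift 1 h))
      + yy * fps_const (fps_shift 1 g) + zz * fps_shift 1 f"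
    using f by metis
  then show ?thesis by blast
qed

text \<open>If all values of \<open>D\<close> have order at least n, then D f = x D f1 + y D f2 + z
  D f3 has order at least n + 1; only 0 has every order.\<close>

lemma derivation_eq_0:
  assumes add: "\<And>f g. D (f + g) = D f + D g"
    and smult: "\<And>r f. D (cst r * f) = cst r * D f"
    and leibniz: "\<And>f g. D (f * g) = D f * g + f * D g"
    and vars: "D xx = 0" "D yy = 0" "D zz = 0"
  shows "D f = (0 :: ser)"
proof -
  have "D 1 = D 1 + D 1"
    using leibniz[of 1 1] by simp
  then have D_cst: "D (cst r) = 0" for r
    using smult[of r 1] by simp
  have "order_ge n (D f)" for n
  proof (induction n arbitrary: f)
    case (Suc n)
    obtain r f1 f2 f3 where f: "f = cst r + xx * f1 + yy * f2 + zz * f3"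
      using ser_decompose by blast
    have "D f = xx * D f1 + yy * D f2 + zz * D f3"
      by (simp add: f add leibniz vars D_cst)
    moreover have "order_ge (1 + n) (xx * D f1 + yy * D f2 + zz * D f3)"
      by (intro order_ge_add order_ge_mult order_ge_vars Suc)
    ultimately show ?case by simp
  qed simp
  then show ?thesis
    by (intro ser_eqI) (metis lessI mcoeff_0 order_ge_def)
qed

lemma is_poissonD:
  assumes "is_poisson P"
  shows "P h (f + g) = P h f + P h g" "P h (cst r * f) = cst r * P h f"
    "P f g = - P g f" "P f (g * h) = P f g * h + g * P f h"
    "P xx yy = xx" "P xx zz = 2 * yy" "P yy zz = zz"
  using assms unfolding is_poisson_def by blast+

text \<open>The difference \<open>R\<close> of two brackets is antisymmetric and a derivation in its
  second argument, and it vanishes on pairs of coordinates. So \<open>derivation_eq_0\<close> can be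
  applied to one argument after the other.\<close>

lemma is_poisson_unique:
  assumes P: "is_poisson P" and Q: "is_poisson Q"
  shows "P = Q"
proof -
  define R where "R f g = P f g - Q f g" for f g
  note D = is_poissonD(1,2,4)[OF P] is_poissonD(1,2,4)[OF Q]
  have deriv: "R f g = 0" if "R f xx = 0" "R f yy = 0" "R f zz = 0" for f g
  proof (rule derivation_eq_0[of "R f"])
    show "R f (g + h) = R f g + R f h" for g h
      by (simp add: R_def D(1,4))
    show "R f (cst r * g) = cst r * R f g" for r g
      by (simp add: R_def D(2,5) right_diff_distrib)
    show "R f (g * h) = R f g * h + g * R f h" for g h
      by (simp add: R_def D(3,6) algebra_simps)
  qed (use that in simp_all)
  have anti: "R f g = - R g f" for f g
    unfolding R_def is_poissonD(3)[OF P, of f g] is_poissonD(3)[OF Q, of f g] by simp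
  have self: "R f f = 0" for f
  proof -
    have "2 * R f f = 0"
      unfolding mult_2 by (rule iffD1[OF eq_neg_iff_add_eq_0 anti])
    then show ?thesis by simp
  qed
  have coords: "R xx yy = 0" "R xx zz = 0" "R yy zz = 0"
    by (simp_all add: R_def is_poissonD(5-7)[OF P] is_poissonD(5-7)[OF Q])
  \<comment> \<open>First pass: a coordinate is held fixed on the left. Antisymmetry then supplies
    the hypotheses of the second pass, for an arbitrary left argument.\<close>
  have R_coords: "R xx g = 0" "R yy g = 0" "R zz g = 0" for g
    by (rule deriv; simp add: self coords anti[of yy xx] anti[of zz xx] anti[of zz yy])+
  have "R f g = 0" for f g
    by (rule deriv; simp add: R_coords anti[of f xx] anti[of f yy] anti[of f zz])
  then show ?thesis
    by (simp add: R_def fun_eq_iff)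
qed

lemma poisson_eq: "poisson = jacobi_bracket"
  unfolding poisson_def
  by (rule the_equality[where P = is_poisson, OF is_poisson_jacobi_bracket])
    (erule is_poisson_unique[OF _ is_poisson_jacobi_bracket])

lemma poisson_coord: "poisson (coord j) f = vec_nth (hamiltonian f) j"
  using exhaust_3[of j]
  by (auto simp: poisson_eq jacobi_bracket_def coord_def algebra_simps)

text \<open>\<open>Delta\<close> is a Casimir function: the determinant has two equal rows.\<close>

lemma poisson_Delta: "poisson f Delta = 0"
  by (simp add: poisson_eq jacobi_bracket_def algebra_simps)


section \<open>The normal form\<close>

text \<open>With m = k + p - 2i, the right-hand side is k + p + m. Thus the order of a term bounds
  \<open>k\<close>, and only finitely many terms of the normal form have order at most a given
  n.\<close>

lemma nf_degree: "i \<le> (k + p) div 2 \<Longrightarrow> k \<le> 2 * (i + (k + p - 2 * i))" for i k p :: nat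
proof -
  assume "i \<le> (k + p) div 2"
  then have "2 * i \<le> k + p" by simp
  then obtain d where "k + p = 2 * i + d" using le_Suc_ex by blast
  then show ?thesis by simp
qed

lemma formally_summable_nf:
  "formally_summable (\<lambda>(k, i). cst (c k i) * bterm (- 1) i (k + p - 2 * i))
     (SIGMA k:{p + 1..}. {0..(k + p) div 2})"
proof (rule formally_summableI_order[where d = "\<lambda>(k, i). i + (k + p - 2 * i)"])
  show "order_ge (case s of (k, i) \<Rightarrow> i + (k + p - 2 * i))
      (case s of (k, i) \<Rightarrow> cst (c k i) * bterm (- 1) i (k + p - 2 * i))" for s
    by (auto simp: order_ge_cst_mult order_ge_bterm split: prod.splits)
  fix n
  have "{s \<in> SIGMA k:{p + 1..}. {0..(k + p) div 2}. (case s of (k, i) \<Rightarrow> i + (k + p - 2 * i)) \<le> n}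
      \<subseteq> {..2 * n} \<times> {..n}"
    using nf_degree by fastforce
  then show "finite {s \<in> SIGMA k:{p + 1..}. {0..(k + p) div 2}.
      (case s of (k, i) \<Rightarrow> i + (k + p - 2 * i)) \<le> n}"
    by (rule finite_subset) simp
qed

section \<open>The terms of the normal form as b-terms and B-terms\<close>

lemma bterm_m1: "bterm (- 1) i k = - (cst (1 / real (i + 1)) * zz ^ (i + 1) * Delta ^ k)"
  by (simp add: bterm_def kappa_def)

lemma Bterm_m1: "Bterm (- 1) i k = (zz ^ i * Delta ^ k) *s vM"
  by (simp add: Bterm_def kappa_def)

lemma bterm_1_0_0: "bterm 1 0 0 = - xx"
proof -
  \<comment> \<open>N z = 2y and N y = x. The resulting 2 cancels against
    \<open>kappa 2 2\<close>.\<close>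
  have "(vf_apply vN ^^ 2) zz = 2 * xx"
    by (simp add: numeral_2_eq_2 vf_apply_def)
  moreover have "cst (1 / 2) * 2 = 1"
    using cst_mult[of "1 / 2" "of_nat 2"] by (simp only: cst_of_nat) simp
  ultimately show ?thesis
    by (simp add: bterm_def kappa_def numeral_2_eq_2[symmetric] flip: mult.assoc)
qed

text \<open>Places the function in the domain of \<open>Psi\<close>, where
  \<open>Psi_eq_hamiltonian\<close> applies.\<close>

lemma nf_formal_sum_bterm:
  obtains c where
    "bterm 1 0 0 + bterm (- 1) p 0 + formal_sum (\<lambda>k. \<Sum>i = 0..(k + p) div 2.
        cst (b i k) * bterm (- 1) i (k + p - 2 * i)) {p + 1..}
      = formal_sum (\<lambda>(l, i, k). cst (c l i k) * bterm l i k) Bindex"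
proof
  \<comment> \<open>\<open>c0\<close> carries the two leading terms.\<close>
  define c0 :: "int \<Rightarrow> nat \<Rightarrow> nat \<Rightarrow> real" where
    "c0 l i m = (if (l, i, m) \<in> {(1, 0, 0), (- 1, p, 0)} then 1 else 0)" for l i m
  \<comment> \<open>\<open>c1\<close> carries the remaining sum. From m = k + p - 2i the index k = m
    + 2i - p is recovered, and k \<ge> p + 1 becomes 2p + 1 \<le> m + 2i.\<close>
  define c1 :: "int \<Rightarrow> nat \<Rightarrow> nat \<Rightarrow> real" where
    "c1 l i m = (if l = - 1 \<and> 2 * p + 1 \<le> m + 2 * i then b i (m + 2 * i - p) else 0)" for l i m
  define A where "A = (SIGMA k:{p + 1..}. {0..(k + p) div 2})"
  define h :: "nat \<times> nat \<Rightarrow> int \<times> nat \<times> nat" where "h = (\<lambda>(k, i). (- 1, i, k + p - 2 * i))"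
  let ?F = "\<lambda>c (l, i, m). cst (c l i m) * bterm l i m"
  have sub: "h ` A \<subseteq> Bindex"
    by (auto simp: A_def h_def Bindex_def)
  have "formal_sum (?F c0) Bindex = formal_sum (?F c0) {(1, 0, 0), (- 1, p, 0)}"
  proof (rule formal_sum_mono_neutral)
    show "{(1, 0, 0), (- 1, p, 0)} \<subseteq> Bindex"
      by (simp add: Bindex_def)
    show "?F c0 s = 0" if "s \<in> Bindex - {(1, 0, 0), (- 1, p, 0)}" for s
    proof -
      obtain l i m where s: "s = (l, i, m)" by (cases s)
      with that have "c0 l i m = 0" by (simp add: c0_def)
      with s show ?thesis by simp
    qed
  qed
  also have "\<dots> = bterm 1 0 0 + bterm (- 1) p 0"
    by (simp add: formal_sum_finite c0_def)
  finally have c0: "formal_sum (?F c0) Bindex = bterm 1 0 0 + bterm (- 1) p 0" .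
  have "formal_sum (?F c1) Bindex = formal_sum (?F c1) (h ` A)"
  proof (rule formal_sum_mono_neutral[OF sub])
    fix s assume *: "s \<in> Bindex - h ` A"
    obtain l i m where s: "s = (l, i, m)" by (cases s)
    have "c1 l i m = 0"
    proof (rule ccontr)
      assume "c1 l i m \<noteq> 0"
      then have "l = - 1" "2 * p + 1 \<le> m + 2 * i"
        by (auto simp: c1_def split: if_splits)
      then have "(l, i, m) = h (m + 2 * i - p, i)" "(m + 2 * i - p, i) \<in> A"
        by (auto simp: h_def A_def)
      with * s show False by (metis DiffE imageI)
    qed
    with s show "?F c1 s = 0" by simp
  qed
  also have "\<dots> = formal_sum (?F c1 \<circ> h) A"
    \<comment> \<open>On \<open>A\<close> the subtraction in \<open>h\<close> is not truncated, so i
      and k + p - 2i determine k.\<close>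
    by (rule formal_sum_reindex) (auto simp: inj_on_def h_def A_def)
  also have "\<dots> = formal_sum (\<lambda>(k, i). cst (b i k) * bterm (- 1) i (k + p - 2 * i)) A"
    by (rule formal_sum_cong) (auto simp: h_def A_def c1_def)
  also have "\<dots> = formal_sum (\<lambda>k. \<Sum>i = 0..(k + p) div 2.
        cst (b i k) * bterm (- 1) i (k + p - 2 * i)) {p + 1..}"
    unfolding A_def by (rule formal_sum_Sigma[OF formally_summable_nf]) simp
  finally have c1: "formal_sum (?F c1) Bindex = \<dots>" .
  have "formal_sum (?F (\<lambda>l i m. c0 l i m + c1 l i m)) Bindex
      = formal_sum (\<lambda>s. ?F c0 s + ?F c1 s) Bindex"
    by (rule formal_sum_cong) (auto simp: cst_def distrib_right simp flip: fps_const_add)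
  also have "\<dots> = formal_sum (?F c0) Bindex + formal_sum (?F c1) Bindex"
    by (intro formal_sum_add formally_summable_bterm)
  finally show "bterm 1 0 0 + bterm (- 1) p 0 + formal_sum (\<lambda>k. \<Sum>i = 0..(k + p) div 2.
        cst (b i k) * bterm (- 1) i (k + p - 2 * i)) {p + 1..}
      = formal_sum (?F (\<lambda>l i m. c0 l i m + c1 l i m)) Bindex"
    by (simp only: c0 c1)
qed

section \<open>The five representations of the normal form\<close>

theorem corollary5p2:
  fixes p :: nat and b :: "nat \<Rightarrow> nat \<Rightarrow> real" and w :: vf and I :: ser
  assumes "w = - (xx *s d_dy) - (2 * yy) *s d_dz
      + zz ^ p *s (zz *s d_dy + (2 * yy) *s d_dx)
      + vf_formal_sum (\<lambda>k. \<Sum>i = 0..(k + p) div 2.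
          (cst (b i k) * zz ^ i * (xx * zz - yy ^ 2) ^ (k + p - 2 * i)) *s
            (zz *s d_dy + (2 * yy) *s d_dx)) {p + 1..}"
    and "I = xx + cst (1 / real (p + 1)) * zz ^ (p + 1)
      + formal_sum (\<lambda>k. \<Sum>i = 0..(k + p) div 2.
          cst (b i k / real (i + 1)) * zz ^ (i + 1) * (xx * zz - yy ^ 2) ^ (k + p - 2 * i)) {p + 1..}"
  shows "w = Bterm 1 0 0 + Bterm (- 1) p 0
      + vf_formal_sum (\<lambda>k. \<Sum>i = 0..(k + p) div 2.
          cst (b i k) *s Bterm (- 1) i (k + p - 2 * i)) {p + 1..}
    \<and> w = Psi (- xx - cst (1 / real (p + 1)) * zz ^ (p + 1)
      - formal_sum (\<lambda>k. \<Sum>i = 0..(k + p) div 2.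
          cst (b i k / real (i + 1)) * zz ^ (i + 1) * (xx * zz - yy ^ 2) ^ (k + p - 2 * i)) {p + 1..})
    \<and> w = curl (I *s vector [zz, - 2 * yy, xx])
    \<and> w = vf_cross (grad I) (grad (xx * zz - yy ^ 2))
    \<and> functionally_independent (xx * zz - yy ^ 2) I
    \<and> w = (\<Sum>j\<in>UNIV. poisson (coord j) I *s axis j 1)
    \<and> poisson I Delta = 0"
proof -
  \<comment> \<open>\<open>f\<close> will be the argument of \<open>Psi\<close> and equals - I. The
    b-terms with l = -1 carry a minus sign and the divisor i + 1, so \<open>- g k\<close> is the
    inner sum of \<open>I\<close>.\<close>
  define g where "g k = (\<Sum>i = 0..(k + p) div 2. cst (b i k) * bterm (- 1) i (k + p - 2 * i))" for k
  define f where "f = bterm 1 0 0 + bterm (- 1) p 0 + formal_sum g {p + 1..}"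
  note Delta_eq = Delta_def[symmetric]
  have g_eq: "- g k = (\<Sum>i = 0..(k + p) div 2.
      cst (b i k / real (i + 1)) * zz ^ (i + 1) * Delta ^ (k + p - 2 * i))" for k
  proof -
    have "cst (b i k) * cst (1 / real (i + 1)) = cst (b i k / real (i + 1))" for i
      by (simp flip: cst_mult)
    then show ?thesis
      by (simp only: g_def bterm_m1 mult_minus_right sum_negf minus_minus flip: mult.assoc)
  qed
  have g_summable: "formally_summable g {p + 1..}"
    unfolding g_def by (rule formally_summable_Sigma[OF formally_summable_nf])
  have "formal_sum (\<lambda>k. - g k) {p + 1..} = - formal_sum g {p + 1..}"
    by (rule ser_eqI) (simp add: mcoeff_formal_sum sum_negf)
  then have f_eq: "f = - xx - cst (1 / real (p + 1)) * zz ^ (p + 1)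
      - formal_sum (\<lambda>k. \<Sum>i = 0..(k + p) div 2.
          cst (b i k / real (i + 1)) * zz ^ (i + 1) * Delta ^ (k + p - 2 * i)) {p + 1..}"
    unfolding f_def g_eq[symmetric] by (simp add: bterm_1_0_0 bterm_m1)
  then have I_eq: "I = - f"
    unfolding assms(2) Delta_eq by simp
  have ham_g: "hamiltonian (- g k) = (\<Sum>i = 0..(k + p) div 2.
      cst (b i k) *s Bterm (- 1) i (k + p - 2 * i))" for k
    by (simp add: g_def hamiltonian_sum Bterm_eq_hamiltonian sum_negf vector_smult_rneg)
  have "formally_summable (\<lambda>k. - g k) {p + 1..}"
    using g_summable by (simp add: formally_summable_def)
  from hamiltonian_formal_sum[OF this]
  have ham_sum: "- hamiltonian (formal_sum g {p + 1..}) = vf_formal_sum (\<lambda>k. \<Sum>i = 0..(k + p) div 2.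
      cst (b i k) *s Bterm (- 1) i (k + p - 2 * i)) {p + 1..}"
    unfolding \<open>formal_sum (\<lambda>k. - g k) {p + 1..} = - formal_sum g {p + 1..}\<close> ham_g
    by simp
  have ham_I: "hamiltonian I = Bterm 1 0 0 + Bterm (- 1) p 0
      + vf_formal_sum (\<lambda>k. \<Sum>i = 0..(k + p) div 2.
          cst (b i k) *s Bterm (- 1) i (k + p - 2 * i)) {p + 1..}"
    unfolding I_eq ham_sum[symmetric] by (simp add: f_def Bterm_eq_hamiltonian)
  \<comment> \<open>The linear part is H x = - N; all other terms are multiples of \<open>vM\<close>
    by \<open>Bterm_m1\<close>.\<close>
  have "Bterm 1 0 0 = - (xx *s d_dy) - (2 * yy) *s d_dz"
    by (simp add: Bterm_eq_hamiltonian bterm_1_0_0 hamiltonian_xx vN_def)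
  then have w1: "w = hamiltonian I"
    unfolding assms(1) ham_I
    by (simp add: Bterm_m1 vector_smult_assoc mult.assoc flip: Delta_def vM_def)
  obtain c where "f = formal_sum (\<lambda>(l, i, k). cst (c l i k) * bterm l i k) Bindex"
    unfolding f_def g_def by (rule nf_formal_sum_bterm)
  from Psi_eq_hamiltonian[OF this] have "w = Psi f"
    by (simp add: w1 I_eq)
  moreover have "functionally_independent Delta I"
  proof (rule functionally_independent_Delta)
    \<comment> \<open>M has no z-component, so only - N contributes here, whatever the coefficients
      \<open>b\<close> are.\<close>
    have "vec_nth (hamiltonian I) 3 = - 2 * yy"
      unfolding w1[symmetric] assms(1)
      by (simp add: vf_formal_sum_def formal_sum_def mcoeff_def d_dx_def d_dy_def d_dz_def axis_def
          fps_zero_def[symmetric])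
    moreover have "yy \<noteq> 0"
      by (simp add: yy_def)
    ultimately show "hamiltonian I \<noteq> 0"
      by (metis mult_eq_0_iff neg_equal_0_iff_equal zero_index zero_neq_numeral)
  qed
  moreover have "w = (\<Sum>j\<in>UNIV. poisson (coord j) I *s axis j 1)"
    by (simp add: w1 poisson_coord vec_eq_iff axis_def if_distrib cong: if_cong)
  ultimately show ?thesis
    unfolding Delta_eq f_eq[symmetric]
    using w1 ham_I hamiltonian_eq_curl[of I] hamiltonian_def[of I] poisson_Delta[of I] by simp
qed

end
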